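(* Let $\Omega,\tau,f,\alpha$ satisfy the assumptions listed in the context, with $L_f$ the Lipschitz constant of $\nabla f$. Suppose $L>L_f$. Let $(u_k)$ be a sequence of iterates generated by the proximal gradient algorithm with parameter $L$, and let $(\lambda_k)_{k\ge1}$ be the associated multipliers. Suppose $$\liminf_{k\to\infty}\lambda_k>0 .$$ Then there is $\bar\chi\in L^1(\Omega)$ such that $\chi_k\to\bar\chi$ in $L^1(\Omega)$, where $\chi_k(x):=|u_k(x)|_0$, and every weak sequential limit point $\bar u$ of $(u_k)$ in $L^2(\Omega)$ is feasible for the $L^0$ constraint, i.e. $\|\bar u\|_0\le\tau$.
   Context: For $u\in\mathbb R$, $|u|_0:=1$ if $u\ne0$ and $|0|_0:=0$; for measurable $u:\Omega\to\mathbb R$, $\|u\|_0:=\int_\Omega|u(x)|_0\,dx=\operatorname{meas}\{x:u(x)\ne0\}$. $\mathcal U_\tau:=\{u:\Omega\to\mathbb R\text{ measurable}:\|u\|_0\le\tau\}$. Assumptions: $\Omega\subset\mathbb R^d$ is Lebesgue measurable with $\operatorname{meas}(\Omega)\in(0,\infty)$, $\tau\in(0,\operatorname{meas}(\Omega))$; $f:L^2(\Omega)\to\mathbb R$ is bounded from below and Fréchet differentiable, and $\nabla f:L^2(\Omega)\to L^2(\Omega)$ is Lipschitz continuous with constant $L_f$; $\alpha\ge0$. Proximal gradient algorithm with parameter $L>0$: choose $u_0\in L^2(\Omega)$; for $k=0,1,2,\dots$ let $u_{k+1}$ be a solution of $$(P_k)\quad\min_{u\in\mathcal U_\tau\cap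 L^2(\Omega)} f(u_k)+\nabla f(u_k)\cdot(u-u_k)+\tfrac L2\|u-u_k\|_{L^2(\Omega)}^2+\tfrac\alpha2\|u\|_{L^2(\Omega)}^2 ,$$ where $\nabla f(u_k)\cdot w=\int_\Omega\nabla f(u_k)w\,dx$. Multipliers: for each $k\ge0$, $\lambda_{k+1}\ge0$ is a number (which exists) such that every solution $u_{k+1}$ of $(P_k)$ satisfies: $\lambda_{k+1}(\|u_{k+1}\|_0-\tau)=0$; $u_{k+1}$ minimizes $f(u_k)+\nabla f(u_k)\cdot(u-u_k)+\frac L2\|u-u_k\|^2_{L^2(\Omega)}+\frac\alpha2\|u\|^2_{L^2(\Omega)}+\lambda_{k+1}\|u\|_0$ over $u\in L^2(\Omega)$; and for almost all $x\in\Omega$, $u_{k+1}(x)\neq0$ implies $|u_{k+1}(x)|\ge\sqrt{2\lambda_{k+1}/(L+\alpha)}$, and $|u_{k+1}(x)|_0\cdot\big(-\frac1{2(L+\alpha)}(Lu_k(x)-\nabla f(u_k)(x))^2+\lambda_{k+1}\big)\le0$. *)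

theory Defs
  imports "HOL-Analysis.Analysis"
begin

text \<open>
  The space $L^2(\Omega)$ depends on the set $\Omega$, so it is not available as a type.  Its
  elements are represented by square integrable functions on the measure space
  \<open>M = lebesgue_on \<Omega>\<close>; two functions represent the same element iff they agree
  almost everywhere.  Functionals and operators on $L^2(\Omega)$ are functions on representatives
  that respect this equivalence.
\<close>

definition L2_space :: "'a measure \<Rightarrow> ('a \<Rightarrow> real) set" where
  "L2_space M = {u. u \<in> borel_measurable M \<and> integrable M (\<lambda>x. (u x)\<^sup>2)}"

definition L2_inner :: "'a measure \<Rightarrow> ('a \<Rightarrow> real) \<Rightarrow> ('a \<Rightarrow> real) \<Rightarrow> real" where
  "L2_inner M u v = (\<integral>x. u x * v x \<partial>M)"

definition L2_norm :: "'a measure \<Rightarrow> ('a \<Rightarrow> real) \<Rightarrow> real" where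
  "L2_norm M u = sqrt (L2_inner M u u)"

definition abs0 :: "real \<Rightarrow> real" where
  "abs0 t = (if t \<noteq> 0 then 1 else 0)"

text \<open>
  On a finite measure space, such as all those considered here, the integrand below is integrable
  for every measurable \<open>u\<close>, so the integral is the measure of the support of \<open>u\<close>.
\<close>

definition L0_norm :: "'a measure \<Rightarrow> ('a \<Rightarrow> real) \<Rightarrow> real" where
  "L0_norm M u = (\<integral>x. abs0 (u x) \<partial>M)"

definition L0_ball :: "'a measure \<Rightarrow> real \<Rightarrow> ('a \<Rightarrow> real) set" where
  "L0_ball M \<tau> = {u. u \<in> borel_measurable M \<and> L0_norm M u \<le> \<tau>}"

definition respects_AE_on_L2 :: "'a measure \<Rightarrow> (('a \<Rightarrow> real) \<Rightarrow> real) \<Rightarrow> bool" where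
  "respects_AE_on_L2 M f \<longleftrightarrow>
     (\<forall>u\<in>L2_space M. \<forall>v\<in>L2_space M. (AE x in M. u x = v x) \<longrightarrow> f u = f v)"

text \<open>
  Frechet differentiability of \<open>f\<close> at \<open>u\<close>, where the derivative, a bounded linear functional on
  $L^2$, is represented by \<open>g\<close> through the inner product.
\<close>

definition has_L2_gradient ::
    "'a measure \<Rightarrow> (('a \<Rightarrow> real) \<Rightarrow> real) \<Rightarrow> ('a \<Rightarrow> real) \<Rightarrow> ('a \<Rightarrow> real) \<Rightarrow> bool" where
  "has_L2_gradient M f g u \<longleftrightarrow> g \<in> L2_space M \<and>
     (\<forall>\<epsilon>>0. \<exists>\<delta>>0. \<forall>h\<in>L2_space M. L2_norm M h < \<delta> \<longrightarrow>
        \<bar>f (\<lambda>x. u x + h x) - f u - L2_inner M g h\<bar> \<le> \<epsilon> * L2_norm M h)"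

definition L2_lipschitz :: "'a measure \<Rightarrow> real \<Rightarrow> (('a \<Rightarrow> real) \<Rightarrow> ('a \<Rightarrow> real)) \<Rightarrow> bool" where
  "L2_lipschitz M C G \<longleftrightarrow> 0 \<le> C \<and>
     (\<forall>u\<in>L2_space M. \<forall>v\<in>L2_space M.
        L2_norm M (\<lambda>x. G u x - G v x) \<le> C * L2_norm M (\<lambda>x. u x - v x))"

text \<open>In the following, \<open>G\<close> is the gradient map of \<open>f\<close>, and \<open>w\<close> is the current iterate.\<close>

definition prox_objective ::
    "'a measure \<Rightarrow> (('a \<Rightarrow> real) \<Rightarrow> real) \<Rightarrow> (('a \<Rightarrow> real) \<Rightarrow> ('a \<Rightarrow> real)) \<Rightarrow>
     real \<Rightarrow> real \<Rightarrow> ('a \<Rightarrow> real) \<Rightarrow> ('a \<Rightarrow> real) \<Rightarrow> real" where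
  "prox_objective M f G L \<alpha> w u =
     f w + L2_inner M (G w) (\<lambda>x. u x - w x) + L / 2 * (L2_norm M (\<lambda>x. u x - w x))\<^sup>2
       + \<alpha> / 2 * (L2_norm M u)\<^sup>2"

definition prox_solution ::
    "'a measure \<Rightarrow> (('a \<Rightarrow> real) \<Rightarrow> real) \<Rightarrow> (('a \<Rightarrow> real) \<Rightarrow> ('a \<Rightarrow> real)) \<Rightarrow>
     real \<Rightarrow> real \<Rightarrow> real \<Rightarrow> ('a \<Rightarrow> real) \<Rightarrow> ('a \<Rightarrow> real) \<Rightarrow> bool" where
  "prox_solution M f G L \<alpha> \<tau> w v \<longleftrightarrow>
     is_arg_min (prox_objective M f G L \<alpha> w) (\<lambda>u. u \<in> L0_ball M \<tau> \<inter> L2_space M) v"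

definition prox_gradient_iterates ::
    "'a measure \<Rightarrow> (('a \<Rightarrow> real) \<Rightarrow> real) \<Rightarrow> (('a \<Rightarrow> real) \<Rightarrow> ('a \<Rightarrow> real)) \<Rightarrow>
     real \<Rightarrow> real \<Rightarrow> real \<Rightarrow> (nat \<Rightarrow> 'a \<Rightarrow> real) \<Rightarrow> bool" where
  "prox_gradient_iterates M f G L \<alpha> \<tau> u \<longleftrightarrow>
     u 0 \<in> L2_space M \<and> (\<forall>k. prox_solution M f G L \<alpha> \<tau> (u k) (u (Suc k)))"

definition prox_multiplier ::
    "'a measure \<Rightarrow> (('a \<Rightarrow> real) \<Rightarrow> real) \<Rightarrow> (('a \<Rightarrow> real) \<Rightarrow> ('a \<Rightarrow> real)) \<Rightarrow>
     real \<Rightarrow> real \<Rightarrow> real \<Rightarrow> ('a \<Rightarrow> real) \<Rightarrow> real \<Rightarrow> bool" where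
  "prox_multiplier M f G L \<alpha> \<tau> w \<mu> \<longleftrightarrow> 0 \<le> \<mu> \<and>
     (\<forall>v. prox_solution M f G L \<alpha> \<tau> w v \<longrightarrow>
        \<mu> * (L0_norm M v - \<tau>) = 0 \<and>
        is_arg_min (\<lambda>u. prox_objective M f G L \<alpha> w u + \<mu> * L0_norm M u) (\<lambda>u. u \<in> L2_space M) v \<and>
        (AE x in M. (v x \<noteq> 0 \<longrightarrow> \<bar>v x\<bar> \<ge> sqrt (2 * \<mu> / (L + \<alpha>))) \<and>
           abs0 (v x) * (- (1 / (2 * (L + \<alpha>))) * (L * w x - G w x)\<^sup>2 + \<mu>) \<le> 0))"

definition tendsto_in_L1 :: "'a measure \<Rightarrow> (nat \<Rightarrow> 'a \<Rightarrow> real) \<Rightarrow> ('a \<Rightarrow> real) \<Rightarrow> bool" where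
  "tendsto_in_L1 M X Y \<longleftrightarrow> (\<forall>k. integrable M (X k)) \<and> integrable M Y \<and>
     (\<lambda>k. \<integral>x. \<bar>X k x - Y x\<bar> \<partial>M) \<longlonglongrightarrow> 0"

definition weakly_tendsto_in_L2 :: "'a measure \<Rightarrow> (nat \<Rightarrow> 'a \<Rightarrow> real) \<Rightarrow> ('a \<Rightarrow> real) \<Rightarrow> bool" where
  "weakly_tendsto_in_L2 M X y \<longleftrightarrow> (\<forall>k. X k \<in> L2_space M) \<and> y \<in> L2_space M \<and>
     (\<forall>v\<in>L2_space M. (\<lambda>k. L2_inner M (X k) v) \<longlonglongrightarrow> L2_inner M y v)"

definition weak_seq_limit_point_L2 :: "'a measure \<Rightarrow> (nat \<Rightarrow> 'a \<Rightarrow> real) \<Rightarrow> ('a \<Rightarrow> real) \<Rightarrow> bool" where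
  "weak_seq_limit_point_L2 M X y \<longleftrightarrow>
     (\<exists>r::nat \<Rightarrow> nat. strict_mono r \<and> weakly_tendsto_in_L2 M (X \<circ> r) y)"

end

theory Submission
  imports Defs
begin

text \<open>
  The descent lemma and the minimality of the iterates make the squared $L^2$-increments summable.
  Since the multipliers are eventually bounded away from zero, nonzero values of the iterates are
  eventually at least some \<open>s > 0\<close> in modulus, so each point where two consecutive supports differ
  contributes at least \<open>s\<^sup>2\<close> to the squared increment.  Hence the $L^1$-increments of the support
  indicators are summable as well, and the supports converge almost everywhere, that is, they are
  eventually constant at almost every point.  A weak limit point vanishes off the limiting support.
\<close>

section \<open>Square integrable representatives: algebra and the Cauchy-Schwarz inequality\<close>

text \<open>The sum of the two squares dominates the product. This integrability is what allows
  squares of sums to be expanded and integrated termwise later on.\<close>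

lemma L2_inner_integrable:
  assumes "u \<in> L2_space M" "v \<in> L2_space M"
  shows "integrable M (\<lambda>x. u x * v x)"
proof (rule Bochner_Integration.integrable_bound)
  show "integrable M (\<lambda>x. (u x)\<^sup>2 + (v x)\<^sup>2)"
    using assms by (auto simp: L2_space_def)
  show "(\<lambda>x. u x * v x) \<in> borel_measurable M"
    using assms by (auto simp: L2_space_def)
  have "\<bar>a * b\<bar> \<le> a\<^sup>2 + b\<^sup>2" for a b :: real
  proof -
    have "2 * \<bar>a * b\<bar> \<le> a\<^sup>2 + b\<^sup>2"
      using sum_squares_bound[of "\<bar>a\<bar>" "\<bar>b\<bar>"] by (simp add: abs_mult mult.assoc)
    then show ?thesis
      using abs_ge_zero[of "a * b"] by linarith
  qed
  then show "AE x in M. norm (u x * v x) \<le> norm ((u x)\<^sup>2 + (v x)\<^sup>2)"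
    by simp
qed

lemma L2_space_add:
  assumes "u \<in> L2_space M" "v \<in> L2_space M"
  shows "(\<lambda>x. u x + v x) \<in> L2_space M"
  using assms L2_inner_integrable[OF assms]
  by (auto simp: L2_space_def power2_sum mult.assoc)

lemma L2_space_scale:
  assumes "u \<in> L2_space M"
  shows "(\<lambda>x. c * u x) \<in> L2_space M"
  using assms by (auto simp: L2_space_def power_mult_distrib)

lemma L2_space_diff:
  assumes "u \<in> L2_space M" "v \<in> L2_space M"
  shows "(\<lambda>x. u x - v x) \<in> L2_space M"
  using L2_space_add[OF assms(1) L2_space_scale[OF assms(2), of "-1"]] by simp

lemma L2_norm_nonneg [simp]: "0 \<le> L2_norm M u"
  by (simp add: L2_norm_def L2_inner_def)

lemma L2_norm_power2: "(L2_norm M u)\<^sup>2 = (\<integral>x. (u x)\<^sup>2 \<partial>M)"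
  by (simp add: L2_norm_def L2_inner_def flip: power2_eq_square)

lemma L2_norm_scale: "L2_norm M (\<lambda>x. c * u x) = \<bar>c\<bar> * L2_norm M u"
proof -
  have "L2_inner M (\<lambda>x. c * u x) (\<lambda>x. c * u x) = c\<^sup>2 * L2_inner M u u"
    by (simp add: L2_inner_def power2_eq_square ac_simps flip: integral_mult_right_zero)
  then show ?thesis
    by (simp add: L2_norm_def real_sqrt_mult)
qed

lemma L2_inner_scale_right: "L2_inner M u (\<lambda>x. c * v x) = c * L2_inner M u v"
  by (simp add: L2_inner_def ac_simps flip: integral_mult_right_zero)

lemma L2_inner_diff_left:
  assumes "u \<in> L2_space M" "v \<in> L2_space M" "w \<in> L2_space M"
  shows "L2_inner M (\<lambda>x. u x - v x) w = L2_inner M u w - L2_inner M v w"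
  using assms by (simp add: L2_inner_def left_diff_distrib L2_inner_integrable)

text \<open>For \<open>a > 0\<close> evaluate at the vertex \<open>- b / a\<close>; for
  \<open>a = 0\<close> an affine function that stays nonnegative on the whole line has slope
  zero.\<close>

lemma nonneg_quadratic_discriminant:
  fixes a b c :: real
  assumes nonneg: "\<And>t. 0 \<le> a * t\<^sup>2 + 2 * b * t + c" and "0 \<le> a"
  shows "b\<^sup>2 \<le> a * c"
proof (cases "a = 0")
  case True
  have "b = 0"
  proof (rule ccontr)
    assume "b \<noteq> 0"
    \<comment> \<open>At this point the affine function takes the value -1.\<close>
    with nonneg[of "- (c + 1) / (2 * b)"] True show False
      by simp
  qed
  with True show ?thesis
    by simp
next
  case False
  with \<open>0 \<le> a\<close> have "0 < a" by simp
  have "a * (- b / a)\<^sup>2 + 2 * b * (- b / a) + c = c - b\<^sup>2 / a"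
    using \<open>0 < a\<close> by (simp add: power2_eq_square field_simps)
  with nonneg[of "- b / a"] have "b\<^sup>2 / a \<le> c" by simp
  with \<open>0 < a\<close> show ?thesis by (simp add: field_simps)
qed

text \<open>The integral of the square of \<open>t * u x + v x\<close> is a nonnegative quadratic
  polynomial in \<open>t\<close>, so the discriminant bound applies. This also covers
  \<open>u\<close> of norm zero without a separate case.\<close>

lemma L2_Cauchy_Schwarz:
  assumes "u \<in> L2_space M" "v \<in> L2_space M"
  shows "L2_inner M u v \<le> L2_norm M u * L2_norm M v"
proof -
  have int: "integrable M (\<lambda>x. (u x)\<^sup>2)" "integrable M (\<lambda>x. (v x)\<^sup>2)"
    using assms by (auto simp: L2_space_def)
  have "0 \<le> (L2_norm M u)\<^sup>2 * t\<^sup>2 + 2 * L2_inner M u v * t + (L2_norm M v)\<^sup>2" for t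
  proof -
    have "0 \<le> (\<integral>x. (t * u x + v x)\<^sup>2 \<partial>M)"
      by simp
    also have "\<dots> = (\<integral>x. t\<^sup>2 * (u x)\<^sup>2 + (2 * t) * (u x * v x) + (v x)\<^sup>2 \<partial>M)"
      by (simp add: power2_sum power_mult_distrib ac_simps)
    also have "\<dots> = t\<^sup>2 * (L2_norm M u)\<^sup>2 + (2 * t) * L2_inner M u v + (L2_norm M v)\<^sup>2"
      using int L2_inner_integrable[OF assms]
      by (simp add: L2_norm_power2 L2_inner_def)
    finally show ?thesis
      by (simp add: ac_simps)
  qed
  then have "(L2_inner M u v)\<^sup>2 \<le> (L2_norm M u * L2_norm M v)\<^sup>2"
    unfolding power_mult_distrib by (rule nonneg_quadratic_discriminant) simp
  then show ?thesis
    by (rule power2_le_imp_le) simp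
qed

section \<open>Descent lemma for functionals with Lipschitz gradient\<close>

text \<open>Restricting the Frechet expansion to increments \<open>s * h\<close> turns questions
  about \<open>f\<close> on a segment into calculus of one real variable.\<close>

lemma has_L2_gradient_line_derivative:
  assumes u: "u \<in> L2_space M" and h: "h \<in> L2_space M"
    and grad: "has_L2_gradient M f g (\<lambda>x. u x + t * h x)"
  shows "((\<lambda>s. f (\<lambda>x. u x + s * h x)) has_real_derivative L2_inner M g h) (at t)"
proof -
  define n where "n = L2_norm M h"
  have n: "0 \<le> n" by (simp add: n_def)
  have "\<exists>d>0. \<forall>s::real. s \<noteq> 0 \<and> norm (s - 0) < d \<longrightarrow>
      norm ((f (\<lambda>x. u x + (t + s) * h x) - f (\<lambda>x. u x + t * h x)) / s - L2_inner M g h) < e"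
    if "0 < e" for e :: real
  proof -
    \<comment> \<open>Dividing by \<open>n + 1\<close> rather than \<open>n\<close> covers
      directions \<open>h\<close> of norm zero and makes \<open>e' * n < e\<close> strict. The
      radius \<open>\<delta> / (n + 1)\<close> below is chosen for the same reason.\<close>
    define e' where "e' = e / (n + 1)"
    have e': "0 < e'" "e' * n < e"
      using that n by (auto simp: e'_def field_simps)
    obtain \<delta> where \<delta>: "0 < \<delta>" and le: "\<And>k. k \<in> L2_space M \<Longrightarrow> L2_norm M k < \<delta> \<Longrightarrow>
        \<bar>f (\<lambda>x. u x + t * h x + k x) - f (\<lambda>x. u x + t * h x) - L2_inner M g k\<bar> \<le> e' * L2_norm M k"
      using grad e'(1) unfolding has_L2_gradient_def by blast
    show ?thesis
    proof (intro exI[of _ "\<delta> / (n + 1)"] conjI allI impI)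
      show "0 < \<delta> / (n + 1)" using \<delta> n by simp
      fix s :: real assume s: "s \<noteq> 0 \<and> norm (s - 0) < \<delta> / (n + 1)"
      then have "\<bar>s\<bar> * (n + 1) < \<delta>" using n by (simp add: field_simps)
      then have "\<bar>s\<bar> * n < \<delta>" by (simp add: distrib_left)
      then have "\<bar>f (\<lambda>x. u x + t * h x + s * h x) - f (\<lambda>x. u x + t * h x) - s * L2_inner M g h\<bar>
          \<le> e' * (\<bar>s\<bar> * n)"
        using le[OF L2_space_scale[OF h, of s]] by (simp add: L2_norm_scale L2_inner_scale_right n_def)
      also have "\<dots> < e * \<bar>s\<bar>"
        using mult_strict_right_mono[OF e'(2), of "\<bar>s\<bar>"] s by (simp add: ac_simps)
      finally have "\<bar>(f (\<lambda>x. u x + (t + s) * h x) - f (\<lambda>x. u x + t * h x)) - s * L2_inner M g h\<bar>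
          < e * \<bar>s\<bar>"
        by (simp add: distrib_right add.assoc)
      moreover have "(f (\<lambda>x. u x + (t + s) * h x) - f (\<lambda>x. u x + t * h x)) / s - L2_inner M g h
          = (f (\<lambda>x. u x + (t + s) * h x) - f (\<lambda>x. u x + t * h x) - s * L2_inner M g h) / s"
        using s by (simp add: field_simps)
      ultimately show "norm ((f (\<lambda>x. u x + (t + s) * h x) - f (\<lambda>x. u x + t * h x)) / s - L2_inner M g h) < e"
        using s by (simp add: abs_divide divide_less_eq)
    qed
  qed
  then show ?thesis
    unfolding DERIV_def by (intro LIM_I)
qed

text \<open>Subtract the linear and quadratic terms of the bound from \<open>f\<close> along the
  segment from \<open>u\<close> to \<open>u + h\<close>. By Cauchy-Schwarz and the Lipschitz bound
  the difference \<open>q\<close> has nonpositive derivative on [0, 1], and the claim is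
  \<open>q 1 \<le> q 0\<close>. Monotonicity takes the place of integrating the derivative over the
  segment.\<close>

lemma L2_descent:
  assumes grad: "\<forall>v\<in>L2_space M. has_L2_gradient M f (G v) v"
    and lip: "L2_lipschitz M C G"
    and u: "u \<in> L2_space M" and h: "h \<in> L2_space M"
  shows "f (\<lambda>x. u x + h x) \<le> f u + L2_inner M (G u) h + C / 2 * (L2_norm M h)\<^sup>2"
proof -
  define n where "n = L2_norm M h"
  define p where "p t = (\<lambda>x. u x + t * h x)" for t :: real
  define q where "q t = f (p t) - t * L2_inner M (G u) h - C * t\<^sup>2 / 2 * n\<^sup>2" for t
  have p: "p t \<in> L2_space M" for t
    unfolding p_def by (intro L2_space_add L2_space_scale u h)
  have G: "G v \<in> L2_space M" if "v \<in> L2_space M" for v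
    using grad that by (auto simp: has_L2_gradient_def)
  have "q 1 \<le> q 0"
  proof (rule DERIV_nonpos_imp_nonincreasing[where f = q and a = 0 and b = 1])
    fix t :: real assume t: "0 \<le> t"
    have "((\<lambda>s. f (p s)) has_real_derivative L2_inner M (G (p t)) h) (at t)"
      using grad p unfolding p_def by (intro has_L2_gradient_line_derivative u h) auto
    then have "(q has_real_derivative L2_inner M (G (p t)) h - L2_inner M (G u) h - C * t * n\<^sup>2) (at t)"
      unfolding q_def by (auto intro!: derivative_eq_intros)
    moreover have "L2_inner M (G (p t)) h - L2_inner M (G u) h \<le> C * t * n\<^sup>2"
    proof -
      have "L2_inner M (G (p t)) h - L2_inner M (G u) h = L2_inner M (\<lambda>x. G (p t) x - G u x) h"
        by (simp add: L2_inner_diff_left G p u h)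
      also have "\<dots> \<le> L2_norm M (\<lambda>x. G (p t) x - G u x) * n"
        unfolding n_def by (intro L2_Cauchy_Schwarz L2_space_diff G p u h)
      also have "\<dots> \<le> C * L2_norm M (\<lambda>x. p t x - u x) * n"
        using lip p u by (intro mult_right_mono) (auto simp: L2_lipschitz_def n_def)
      also have "\<dots> = C * t * n\<^sup>2"
        using t by (simp add: p_def L2_norm_scale n_def power2_eq_square)
      finally show ?thesis .
    qed
    ultimately show "\<exists>y. (q has_real_derivative y) (at t) \<and> y \<le> 0"
      by force
  qed simp
  then show ?thesis
    by (simp add: q_def p_def n_def)
qed

section \<open>Support indicators: their convergence and the supports of weak limits\<close>

lemma abs0_measurable [measurable]: "abs0 \<in> borel_measurable borel"
  unfolding abs0_def[abs_def] by measurable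

lemma abs0_bounds [simp]: "0 \<le> abs0 t" "abs0 t \<le> 1" "\<bar>abs0 t\<bar> \<le> 1"
  by (auto simp: abs0_def)

lemma (in finite_measure) integrable_abs0:
  assumes "u \<in> borel_measurable M"
  shows "integrable M (\<lambda>x. abs0 (u x))"
  using assms by (intro integrable_const_bound[of _ 1]) auto

text \<open>The left side is nonzero only if exactly one of \<open>a\<close> and \<open>b\<close>
  vanishes; then \<open>a - b\<close> is, up to sign, the other one, of modulus at least
  \<open>s\<close>.\<close>

lemma abs0_diff_le:
  assumes "0 < s" "a \<noteq> 0 \<Longrightarrow> s \<le> \<bar>a\<bar>" "b \<noteq> 0 \<Longrightarrow> s \<le> \<bar>b\<bar>"
  shows "s\<^sup>2 * \<bar>abs0 a - abs0 b\<bar> \<le> (a - b)\<^sup>2"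
  using assms power_mono[of s "\<bar>a\<bar>" 2] power_mono[of s "\<bar>b\<bar>" 2] by (auto simp: abs0_def)

text \<open>Exchanging sum and integral in the extended nonnegative reals shows that the total
  variation of the sequence at \<open>x\<close> has finite integral. It is therefore finite almost
  everywhere, and there the telescoping series of increments converges.\<close>

lemma AE_convergent_if_summable_L1_increments:
  fixes X :: "nat \<Rightarrow> 'a \<Rightarrow> real"
  assumes int: "\<And>k. integrable M (X k)"
    and sum: "summable (\<lambda>k. \<integral>x. \<bar>X (Suc k) x - X k x\<bar> \<partial>M)"
  shows "AE x in M. convergent (\<lambda>k. X k x)"
proof -
  have [measurable]: "X k \<in> borel_measurable M" for k
    using int by auto
  have "(\<integral>\<^sup>+x. (\<Sum>k. ennreal \<bar>X (Suc k) x - X k x\<bar>) \<partial>M)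
      = (\<Sum>k. \<integral>\<^sup>+x. ennreal \<bar>X (Suc k) x - X k x\<bar> \<partial>M)"
    by (rule nn_integral_suminf) simp
  also have "\<dots> = (\<Sum>k. ennreal (\<integral>x. \<bar>X (Suc k) x - X k x\<bar> \<partial>M))"
    by (intro suminf_cong nn_integral_eq_integral) (auto intro!: int)
  also have "\<dots> = ennreal (\<Sum>k. \<integral>x. \<bar>X (Suc k) x - X k x\<bar> \<partial>M)"
    using sum by (intro suminf_ennreal2) auto
  finally have "(\<integral>\<^sup>+x. (\<Sum>k. ennreal \<bar>X (Suc k) x - X k x\<bar>) \<partial>M) \<noteq> \<infinity>"
    by simp
  then have "AE x in M. (\<Sum>k. ennreal \<bar>X (Suc k) x - X k x\<bar>) \<noteq> \<infinity>"
    by (intro nn_integral_PInf_AE) auto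
  then show ?thesis
  proof eventually_elim
    case (elim x)
    then have "summable (\<lambda>k. \<bar>X (Suc k) x - X k x\<bar>)"
      by (intro summable_suminf_not_top) auto
    then have "summable (\<lambda>k. X (Suc k) x - X k x)"
      by (rule summable_rabs_cancel)
    then have "convergent (\<lambda>n. (\<Sum>k<n. X (Suc k) x - X k x) + X 0 x)"
      by (intro convergent_add convergent_const) (simp add: summable_iff_convergent)
    then show ?case
      by (subst (asm) sum_lessThan_telescope) simp
  qed
qed

text \<open>Two values in {0, 1} that are both closer than 1/2 to the limit must coincide.\<close>

lemma abs0_convergent_eventually_const:
  assumes "(\<lambda>k. abs0 (a k)) \<longlonglongrightarrow> c"
  shows "\<exists>N. \<forall>k\<ge>N. abs0 (a k) = c"
proof -
  obtain N where N: "\<forall>k\<ge>N. \<bar>abs0 (a k) - c\<bar> < 1/2"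
    using LIMSEQ_D[OF assms, of "1/2"] by auto
  have const: "\<forall>k\<ge>N. abs0 (a k) = abs0 (a N)"
  proof (intro allI impI)
    show "abs0 (a k) = abs0 (a N)" if "k \<ge> N" for k
      using N[rule_format, of k] N[rule_format, of N] that
      by (auto simp: abs0_def split: if_splits)
  qed
  then have "\<forall>\<^sub>F k in sequentially. abs0 (a k) = abs0 (a N)"
    unfolding eventually_sequentially by blast
  then have "(\<lambda>k. abs0 (a k)) \<longlonglongrightarrow> abs0 (a N)"
    by (rule tendsto_eventually)
  with assms have "c = abs0 (a N)"
    by (rule LIMSEQ_unique)
  with const show ?thesis
    by blast
qed

text \<open>
  On the set where the supports agree with the limiting one from index \<open>N\<close> on, testing with the
  sign of the weak limit off the limiting support gives zero along the sequence.  This needs no norm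
  bound for the weakly convergent sequence.
\<close>
lemma (in finite_measure) weak_limit_support:
  assumes weak: "weakly_tendsto_in_L2 M w v"
    and chi [measurable]: "chi \<in> borel_measurable M"
    and lim: "AE x in M. (\<lambda>k. abs0 (w k x)) \<longlonglongrightarrow> chi x"
  shows "AE x in M. abs0 (v x) \<le> chi x"
proof -
  have w: "w k \<in> L2_space M" and v: "v \<in> L2_space M" for k
    using weak by (auto simp: weakly_tendsto_in_L2_def)
  have [measurable]: "w k \<in> borel_measurable M" "v \<in> borel_measurable M" for k
    using w v by (auto simp: L2_space_def)
  define A where "A N = {x \<in> space M. chi x = 0 \<and> (\<forall>k\<ge>N. w k x = 0)}" for N
  have [measurable]: "A N \<in> sets M" for N
    unfolding A_def by measurable
  have vanish: "AE x in M. x \<in> A N \<longrightarrow> v x = 0" for N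
  proof -
    define z where "z x = sgn (v x) * indicator (A N) x" for x
    have z: "z \<in> L2_space M"
      unfolding L2_space_def z_def
      by (auto intro!: integrable_const_bound[of _ 1] simp: indicator_def sgn_real_def)
    have "L2_inner M (w k) z = 0" if "k \<ge> N" for k
      unfolding L2_inner_def using that
      by (intro integral_eq_zero_AE) (auto simp: z_def A_def indicator_def)
    then have "(\<lambda>k. L2_inner M (w k) z) \<longlonglongrightarrow> 0"
      by (intro tendsto_eventually) (auto simp: eventually_sequentially)
    moreover have "(\<lambda>k. L2_inner M (w k) z) \<longlonglongrightarrow> L2_inner M v z"
      using weak z by (auto simp: weakly_tendsto_in_L2_def)
    ultimately have "L2_inner M v z = 0"
      by (metis LIMSEQ_unique)
    \<comment> \<open>The product is nonnegative, so its vanishing integral forces \<open>v\<close>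
      to vanish almost everywhere on \<open>A N\<close>.\<close>
    moreover have vz: "v x * z x = \<bar>v x\<bar> * indicator (A N) x" for x
      by (simp add: z_def abs_sgn)
    ultimately have "(\<integral>x. v x * z x \<partial>M) = 0"
      by (simp add: L2_inner_def)
    then have "AE x in M. v x * z x = 0"
      by (subst (asm) integral_nonneg_eq_0_iff_AE) (use L2_inner_integrable[OF v z] in \<open>auto simp: vz\<close>)
    then show ?thesis
      by eventually_elim (auto simp: vz)
  qed
  \<comment> \<open>The exceptional null sets are countably many. Almost every point with
    \<open>chi x = 0\<close> lies in some \<open>A N\<close>, because its support indicators are
    eventually constant.\<close>
  then have "AE x in M. \<forall>N. x \<in> A N \<longrightarrow> v x = 0"
    unfolding AE_all_countable by blast
  with lim AE_space show ?thesis
  proof eventually_elim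
    case (elim x)
    obtain N where N: "\<forall>k\<ge>N. abs0 (w k x) = chi x"
      using abs0_convergent_eventually_const[OF elim(1)] by blast
    show ?case
    proof (cases "chi x = 0")
      case True
      with N elim(2) have "x \<in> A N"
        by (auto simp: A_def abs0_def split: if_splits)
      with elim(3) True show ?thesis
        by (auto simp: abs0_def)
    next
      case False
      with N have "chi x = 1"
        by (metis abs0_def order_refl)
      then show ?thesis
        by simp
    qed
  qed
qed

section \<open>Objective decrease and summable increments of the proximal gradient method\<close>

text \<open>Since \<open>w\<close> is feasible, it competes with the minimizer \<open>v\<close> of
  its own subproblem. The descent lemma replaces the linearization at \<open>w\<close> by
  \<open>f v\<close> at the cost of \<open>C / 2\<close> times the squared step, which leaves the
  factor \<open>(L - C) / 2\<close>.\<close>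

lemma prox_step_decrease:
  assumes grad: "\<forall>v\<in>L2_space M. has_L2_gradient M f (G v) v"
    and lip: "L2_lipschitz M C G"
    and w: "w \<in> L0_ball M \<tau> \<inter> L2_space M"
    and sol: "prox_solution M f G L \<alpha> \<tau> w v"
  shows "(L - C) / 2 * (L2_norm M (\<lambda>x. v x - w x))\<^sup>2
    \<le> (f w + \<alpha> / 2 * (L2_norm M w)\<^sup>2) - (f v + \<alpha> / 2 * (L2_norm M v)\<^sup>2)"
proof -
  have v: "v \<in> L2_space M" and
    le: "prox_objective M f G L \<alpha> w v \<le> prox_objective M f G L \<alpha> w w"
    using sol w by (auto simp: prox_solution_def is_arg_min_linorder)
  have "f (\<lambda>x. w x + (v x - w x)) \<le> f w + L2_inner M (G w) (\<lambda>x. v x - w x)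
      + C / 2 * (L2_norm M (\<lambda>x. v x - w x))\<^sup>2"
    using w v by (intro L2_descent[OF grad lip] L2_space_diff) auto
  moreover have "prox_objective M f G L \<alpha> w w = f w + \<alpha> / 2 * (L2_norm M w)\<^sup>2"
    by (simp add: prox_objective_def L2_norm_def L2_inner_def)
  ultimately show ?thesis
    using le by (simp add: prox_objective_def left_diff_distrib diff_divide_distrib)
qed

text \<open>The decreases telescope, and \<open>f\<close> plus the nonnegative quadratic term is
  bounded below.\<close>

lemma prox_increments_summable:
  assumes grad: "\<forall>v\<in>L2_space M. has_L2_gradient M f (G v) v"
    and lip: "L2_lipschitz M C G"
    and bdd: "bdd_below (f ` L2_space M)"
    and "0 \<le> \<alpha>" "C < L"
    and iter: "prox_gradient_iterates M f G L \<alpha> \<tau> u"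
  shows "summable (\<lambda>k. (L2_norm M (\<lambda>x. u (Suc k) x - u k x))\<^sup>2)"
proof -
  define d where "d k = (L2_norm M (\<lambda>x. u (Suc k) x - u k x))\<^sup>2" for k
  define F where "F k = f (u k) + \<alpha> / 2 * (L2_norm M (u k))\<^sup>2" for k
  have sol: "prox_solution M f G L \<alpha> \<tau> (u k) (u (Suc k))" for k
    using iter by (auto simp: prox_gradient_iterates_def)
  have feas: "u (Suc k) \<in> L0_ball M \<tau> \<inter> L2_space M" for k
    using sol[of k] by (auto simp: prox_solution_def is_arg_min_def)
  obtain m where m: "m \<le> f v" if "v \<in> L2_space M" for v
    using bdd by (auto simp: bdd_below_def)
  have F_ge: "m \<le> F (Suc k)" for k
    using m[of "u (Suc k)"] feas[of k] \<open>0 \<le> \<alpha>\<close> by (auto simp: F_def intro: add_increasing2)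
  \<comment> \<open>The starting point \<open>u 0\<close> may violate the support constraint and
    then need not be a competitor in its own subproblem, so the decrease is claimed only from
    \<open>u 1\<close> on. The single term \<open>d 0\<close> does not affect summability.\<close>
  have step: "(L - C) / 2 * d (Suc k) \<le> F (Suc k) - F (Suc (Suc k))" for k
    unfolding d_def F_def by (rule prox_step_decrease[OF grad lip feas sol])
  have "summable (\<lambda>k. (L - C) / 2 * d (Suc k))"
  proof (rule bounded_imp_summable)
    show "0 \<le> (L - C) / 2 * d (Suc k)" for k
      using \<open>C < L\<close> by (simp add: d_def)
    have "(\<Sum>k\<le>n. (L - C) / 2 * d (Suc k)) \<le> (\<Sum>k\<le>n. F (Suc k) - F (Suc (Suc k)))" for n
      by (intro sum_mono step)
    also have "(\<Sum>k\<le>n. F (Suc k) - F (Suc (Suc k))) = F (Suc 0) - F (Suc (Suc n))" for n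
      by (rule sum_telescope)
    finally show "(\<Sum>k\<le>n. (L - C) / 2 * d (Suc k)) \<le> F (Suc 0) - m" for n
      using F_ge[of "Suc n"] by (meson diff_left_mono order_trans)
  qed
  then have "summable (\<lambda>k. d (Suc k))"
    using \<open>C < L\<close> by (simp add: summable_cmult_iff)
  then show ?thesis
    unfolding d_def by (subst (asm) summable_Suc_iff)
qed

text \<open>Integrating the pointwise gap estimate bounds the $L^1$-increment of the supports by
  \<open>1 / s^2\<close> times the squared $L^2$-increment of the iterates.\<close>

lemma (in finite_measure) prox_supports_AE_convergent:
  assumes u: "\<And>k. u k \<in> L2_space M"
    and sum: "summable (\<lambda>k. (L2_norm M (\<lambda>x. u (Suc k) x - u k x))\<^sup>2)"
    and "0 < s"
    and gap: "\<forall>\<^sub>F k in sequentially. AE x in M. u k x \<noteq> 0 \<longrightarrow> s \<le> \<bar>u k x\<bar>"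
  shows "AE x in M. convergent (\<lambda>k. abs0 (u k x))"
proof (rule AE_convergent_if_summable_L1_increments)
  have meas: "u k \<in> borel_measurable M" for k
    using u[of k] by (simp add: L2_space_def)
  show int: "integrable M (\<lambda>x. abs0 (u k x))" for k
    by (intro integrable_abs0 meas)
  have le: "norm (\<integral>x. \<bar>abs0 (u (Suc k) x) - abs0 (u k x)\<bar> \<partial>M)
      \<le> (1 / s\<^sup>2) * (L2_norm M (\<lambda>x. u (Suc k) x - u k x))\<^sup>2"
    if "AE x in M. u k x \<noteq> 0 \<longrightarrow> s \<le> \<bar>u k x\<bar>"
      "AE x in M. u (Suc k) x \<noteq> 0 \<longrightarrow> s \<le> \<bar>u (Suc k) x\<bar>" for k
  proof -
    have "(\<integral>x. s\<^sup>2 * \<bar>abs0 (u (Suc k) x) - abs0 (u k x)\<bar> \<partial>M) \<le> (\<integral>x. (u (Suc k) x - u k x)\<^sup>2 \<partial>M)"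
    proof (rule integral_mono_AE)
      show "integrable M (\<lambda>x. s\<^sup>2 * \<bar>abs0 (u (Suc k) x) - abs0 (u k x)\<bar>)"
        by (auto intro!: int)
      show "integrable M (\<lambda>x. (u (Suc k) x - u k x)\<^sup>2)"
        using L2_space_diff[OF u u, of "Suc k" k] by (simp add: L2_space_def)
      show "AE x in M. s\<^sup>2 * \<bar>abs0 (u (Suc k) x) - abs0 (u k x)\<bar> \<le> (u (Suc k) x - u k x)\<^sup>2"
        using that by eventually_elim (rule abs0_diff_le[OF \<open>0 < s\<close>], auto)
    qed
    then show ?thesis
      using \<open>0 < s\<close> by (simp add: L2_norm_power2 field_simps)
  qed
  show "summable (\<lambda>k. \<integral>x. \<bar>abs0 (u (Suc k) x) - abs0 (u k x)\<bar> \<partial>M)"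
  proof (rule summable_comparison_test_ev)
    show "summable (\<lambda>k. (1 / s\<^sup>2) * (L2_norm M (\<lambda>x. u (Suc k) x - u k x))\<^sup>2)"
      by (intro summable_mult sum)
    \<comment> \<open>An increment involves two consecutive iterates, and both must satisfy the gap
      condition.\<close>
    have "\<forall>\<^sub>F k in sequentially. AE x in M. u (Suc k) x \<noteq> 0 \<longrightarrow> s \<le> \<bar>u (Suc k) x\<bar>"
      using gap by (subst eventually_sequentially_Suc)
    with gap show "\<forall>\<^sub>F k in sequentially. norm (\<integral>x. \<bar>abs0 (u (Suc k) x) - abs0 (u k x)\<bar> \<partial>M)
        \<le> (1 / s\<^sup>2) * (L2_norm M (\<lambda>x. u (Suc k) x - u k x))\<^sup>2"
      by eventually_elim (rule le)
  qed
qed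

section \<open>The limiting support and the feasibility of weak limit points\<close>

theorem theorem5p6:
  fixes \<Omega> :: "'a::euclidean_space set"
    and \<tau> \<alpha> L L\<^sub>f :: real
    and f :: "('a \<Rightarrow> real) \<Rightarrow> real"
    and G :: "('a \<Rightarrow> real) \<Rightarrow> ('a \<Rightarrow> real)"
    and u :: "nat \<Rightarrow> 'a \<Rightarrow> real"
    and \<mu> :: "nat \<Rightarrow> real"
  assumes \<Omega>_meas: "\<Omega> \<in> sets lebesgue"
    and \<Omega>_pos: "0 < emeasure lebesgue \<Omega>"
    and \<Omega>_fin: "emeasure lebesgue \<Omega> < \<infinity>"
    and \<tau>: "0 < \<tau>" "\<tau> < measure lebesgue \<Omega>"
    and \<alpha>: "0 \<le> \<alpha>"
    and f_welldef: "respects_AE_on_L2 (lebesgue_on \<Omega>) f"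
    and f_bdd: "bdd_below (f ` L2_space (lebesgue_on \<Omega>))"
    and f_grad: "\<forall>v\<in>L2_space (lebesgue_on \<Omega>). has_L2_gradient (lebesgue_on \<Omega>) f (G v) v"
    and f_lip: "L2_lipschitz (lebesgue_on \<Omega>) L\<^sub>f G"
    and L: "L\<^sub>f < L"
    and iterates: "prox_gradient_iterates (lebesgue_on \<Omega>) f G L \<alpha> \<tau> u"
    and multipliers: "\<forall>k. prox_multiplier (lebesgue_on \<Omega>) f G L \<alpha> \<tau> (u k) (\<mu> (Suc k))"
    and liminf_pos: "0 < liminf (\<lambda>k. ereal (\<mu> k))"
  shows "(\<exists>chi. tendsto_in_L1 (lebesgue_on \<Omega>) (\<lambda>k x. abs0 (u k x)) chi) \<and>
    (\<forall>v. weak_seq_limit_point_L2 (lebesgue_on \<Omega>) u v \<longrightarrow> L0_norm (lebesgue_on \<Omega>) v \<le> \<tau>)"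
proof -
  define M where "M = lebesgue_on \<Omega>"
  interpret finite_measure M
    using \<Omega>_meas \<Omega>_fin by (intro finite_measureI) (simp add: M_def emeasure_restrict_space)
  have "0 < L"
    using f_lip L by (simp add: L2_lipschitz_def)
  have sol: "prox_solution M f G L \<alpha> \<tau> (u k) (u (Suc k))" for k
    using iterates by (auto simp: M_def prox_gradient_iterates_def)
  have feas: "u (Suc k) \<in> L0_ball M \<tau> \<inter> L2_space M" for k
    using sol[of k] by (auto simp: prox_solution_def is_arg_min_def)
  have u: "u k \<in> L2_space M" for k
    using feas iterates by (cases k) (auto simp: M_def prox_gradient_iterates_def)
  have u_meas [measurable]: "u k \<in> borel_measurable M" for k
    using u[of k] by (simp add: L2_space_def)
  have sum: "summable (\<lambda>k. (L2_norm M (\<lambda>x. u (Suc k) x - u k x))\<^sup>2)"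
    using f_grad f_lip f_bdd \<alpha> L iterates unfolding M_def by (rule prox_increments_summable)
  \<comment> \<open>A real \<open>c\<close> strictly below the limit inferior, which may be
    infinite, is an eventual lower bound for the multipliers. Putting it into the lower bound for
    nonzero values gives a threshold \<open>s\<close> independent of \<open>k\<close>.\<close>
  obtain c where c: "0 < c" "ereal c < liminf (\<lambda>k. ereal (\<mu> k))"
    using ereal_dense2[OF liminf_pos] by auto
  define s where "s = sqrt (2 * c / (L + \<alpha>))"
  have "0 < s"
    using c(1) \<open>0 < L\<close> \<alpha> by (simp add: s_def)
  \<comment> \<open>The shift matches the multiplier \<open>\<mu> (Suc k)\<close> with the step from
    \<open>u k\<close> to \<open>u (Suc k)\<close>.\<close>
  have "\<forall>\<^sub>F k in sequentially. c < \<mu> (Suc k)"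
    using less_LiminfD[OF c(2)] by (subst eventually_sequentially_Suc) simp
  then have "\<forall>\<^sub>F k in sequentially. AE x in M. u (Suc k) x \<noteq> 0 \<longrightarrow> s \<le> \<bar>u (Suc k) x\<bar>"
  proof eventually_elim
    case (elim k)
    have "s \<le> sqrt (2 * \<mu> (Suc k) / (L + \<alpha>))"
      using elim \<open>0 < L\<close> \<alpha> by (simp add: s_def divide_right_mono)
    moreover have "AE x in M. u (Suc k) x \<noteq> 0 \<longrightarrow> sqrt (2 * \<mu> (Suc k) / (L + \<alpha>)) \<le> \<bar>u (Suc k) x\<bar>"
      using multipliers sol[of k] unfolding prox_multiplier_def M_def[symmetric] by auto
    ultimately show ?case
      by (auto elim!: eventually_mono)
  qed
  then have gap: "\<forall>\<^sub>F k in sequentially. AE x in M. u k x \<noteq> 0 \<longrightarrow> s \<le> \<bar>u k x\<bar>"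
    by (subst (asm) eventually_sequentially_Suc)
  \<comment> \<open>Taking \<open>lim\<close> at every point makes \<open>chi\<close> measurable on
    the whole space. Its unspecified value where the sequence diverges matters only on a null
    set.\<close>
  define chi where "chi x = lim (\<lambda>k. abs0 (u k x))" for x
  have chi_meas [measurable]: "chi \<in> borel_measurable M"
    unfolding chi_def by measurable
  have lim: "AE x in M. (\<lambda>k. abs0 (u k x)) \<longlonglongrightarrow> chi x"
    using prox_supports_AE_convergent[OF u sum \<open>0 < s\<close> gap]
    by eventually_elim (simp add: chi_def convergent_LIMSEQ_iff)
  \<comment> \<open>The constant 1 is an integrable majorant because the measure is finite.\<close>
  have bound: "AE x in M. norm (abs0 (u k x)) \<le> 1" for k
    by simp
  have chi_int: "integrable M chi"
    by (rule integrable_dominated_convergence[OF _ _ _ lim bound]) auto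
  have int_lim: "(\<lambda>k. \<integral>x. abs0 (u k x) \<partial>M) \<longlonglongrightarrow> (\<integral>x. chi x \<partial>M)"
    by (rule integral_dominated_convergence[OF _ _ _ lim bound]) auto
  have "(\<lambda>k. \<integral>x. \<bar>abs0 (u k x) - chi x\<bar> \<partial>M) \<longlonglongrightarrow> (\<integral>x. 0 \<partial>M)"
  \<comment> \<open>This majorant follows from the triangle inequality and avoids a separate
    pointwise bound on \<open>chi\<close>.\<close>
  proof (rule integral_dominated_convergence[where w="\<lambda>x. 1 + \<bar>chi x\<bar>"])
    show "AE x in M. (\<lambda>k. \<bar>abs0 (u k x) - chi x\<bar>) \<longlonglongrightarrow> 0"
      using lim by eventually_elim (simp add: LIM_zero tendsto_rabs_zero)
    show "AE x in M. norm \<bar>abs0 (u k x) - chi x\<bar> \<le> 1 + \<bar>chi x\<bar>" for k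
    proof (rule AE_I2)
      show "norm \<bar>abs0 (u k x) - chi x\<bar> \<le> 1 + \<bar>chi x\<bar>" for x
        using abs_triangle_ineq4[of "abs0 (u k x)" "chi x"] abs0_bounds(3)[of "u k x"]
        unfolding real_norm_def by linarith
    qed
  qed (use chi_int in auto)
  then have "tendsto_in_L1 M (\<lambda>k x. abs0 (u k x)) chi"
    using chi_int by (simp add: tendsto_in_L1_def integrable_abs0)
  moreover have "L0_norm M v \<le> \<tau>" if limit: "weak_seq_limit_point_L2 M u v" for v
  proof -
    obtain r where r: "strict_mono r" and weak: "weakly_tendsto_in_L2 M (u \<circ> r) v"
      using limit by (auto simp: weak_seq_limit_point_L2_def)
    \<comment> \<open>The supports converge along the whole sequence, so every subsequence has the
      same limiting support \<open>chi\<close>.\<close>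
    have "AE x in M. (\<lambda>k. abs0 ((u \<circ> r) k x)) \<longlonglongrightarrow> chi x"
      using lim
    proof eventually_elim
      case (elim x)
      from LIMSEQ_subseq_LIMSEQ[OF this r] show ?case
        by (simp add: o_def)
    qed
    then have le: "AE x in M. abs0 (v x) \<le> chi x"
      by (rule weak_limit_support[OF weak chi_meas])
    have "v \<in> borel_measurable M"
      using weak by (simp add: weakly_tendsto_in_L2_def L2_space_def)
    then have "L0_norm M v \<le> (\<integral>x. chi x \<partial>M)"
      unfolding L0_norm_def using le chi_int by (intro integral_mono_AE integrable_abs0)
    also have "(\<integral>x. chi x \<partial>M) \<le> \<tau>"
    \<comment> \<open>The integral of \<open>chi\<close> is the limit of the support measures of the
      iterates. These are at most \<open>\<tau>\<close> from index 1 on, hence the shifted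
      sequence.\<close>
    proof (rule LIMSEQ_le_const2[OF LIMSEQ_Suc[OF int_lim]])
      show "\<exists>N. \<forall>k\<ge>N. (\<integral>x. abs0 (u (Suc k) x) \<partial>M) \<le> \<tau>"
        using feas by (auto simp: L0_ball_def L0_norm_def)
    qed
    finally show ?thesis .
  qed
  ultimately show ?thesis
    unfolding M_def by blast
qed

end
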